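(* Let $(X,d)$ be a metric space, $f:X\to\mathbb{R}\cup\{\pm\infty\}$ a function and $\bar x\in X$ a point with $|f(\bar x)|<\infty$. Then $\bar x$ is a local sharp minimizer of $f$ if and only if $\bar x$ is superstable for the family of perturbed problems $(\mathcal{P}_g)$: $\min_{x\in X}[f(x)+g(x)]$, $g\in\mathcal{G}_{\bar x}$.
   Context: $B(x,r)$ denotes the closed ball with center $x$ and radius $r$. The point $\bar x$ is a local sharp minimizer of $f$ if there exist $\sigma>0$ and $r>0$ such that $f(x)\ge f(\bar x)+\sigma d(x,\bar x)$ for all $x\in B(\bar x,r)$. $\mathcal{G}_{\bar x}$ is the set of all functions $g:X\to\mathbb{R}\cup\{\pm\infty\}$ with $|g(\bar x)|<\infty$. For $g\in\mathcal{G}_{\bar x}$, the strong slope of $g$ at $\bar x$ is $|\nabla g|(\bar x)=0$ if $\bar x$ is a local minimizer of $g$, and $|\nabla g|(\bar x)=\limsup_{x\to\bar x}\frac{g(\bar x)-g(x)}{d(x,\bar x)}$ (limsup over $x\neq\bar x$) otherwise. The point $\bar x$ is called superstable if it is a local solution of $(\mathcal{P}_0)$ (i.e. a local minimizer of $f$) and there exists $\epsilon_0>0$ such that, for every $g\in\mathcal{G}_{\bar x}$ with $|\nabla g|(\bar x)<\epsilon_0$, $\bar x$ is a local solution of $(\mathcal{P}_g)$, i.e. $f(x)+g(x)\ge f(\bar x)+g(\bar x)$ for all $x$ in some neighbourhood of $\bar x$. (Any fixed convention may be adopted for sums of the form $(+\infty)+(-\infty)$; such sums do not occur near $\bar x$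 when $\bar x$ is a local minimizer of $f$ and $|\nabla g|(\bar x)<\infty$.) *)

theory Defs
  imports "HOL-Analysis.Analysis"
begin

definition local_minimizer :: "('a::metric_space \<Rightarrow> ereal) \<Rightarrow> 'a \<Rightarrow> bool" where
  "local_minimizer g x0 \<longleftrightarrow> (\<forall>\<^sub>F x in nhds x0. g x0 \<le> g x)"

definition local_sharp_minimizer :: "('a::metric_space \<Rightarrow> ereal) \<Rightarrow> 'a \<Rightarrow> bool" where
  "local_sharp_minimizer f x0 \<longleftrightarrow>
     (\<exists>\<sigma>>0. \<exists>r>0. \<forall>x\<in>cball x0 r. f x0 + ereal (\<sigma> * dist x x0) \<le> f x)"

definition finite_at :: "'a \<Rightarrow> ('a \<Rightarrow> ereal) set" where
  "finite_at x0 = {g. \<bar>g x0\<bar> < \<infinity>}"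

text \<open>The filter \<open>at x0\<close> excludes \<open>x0\<close> itself. If \<open>x0\<close> is isolated, it is a local minimizer of
  every function, so the \<open>Limsup\<close> is never taken over the trivial filter.\<close>

definition strong_slope :: "('a::metric_space \<Rightarrow> ereal) \<Rightarrow> 'a \<Rightarrow> ereal" where
  "strong_slope g x0 =
     (if local_minimizer g x0 then 0
      else Limsup (at x0) (\<lambda>x. (g x0 - g x) / ereal (dist x x0)))"

text \<open>Sums are taken in \<^typ>\<open>ereal\<close>, so \<open>\<infinity> + (-\<infinity>) = \<infinity>\<close>. The unperturbed problem is the case \<open>g = (\<lambda>_. 0)\<close>.\<close>

definition local_solution ::
    "('a::metric_space \<Rightarrow> ereal) \<Rightarrow> ('a \<Rightarrow> ereal) \<Rightarrow> 'a \<Rightarrow> bool" where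
  "local_solution f g x0 \<longleftrightarrow> local_minimizer (\<lambda>x. f x + g x) x0"

definition superstable :: "('a::metric_space \<Rightarrow> ereal) \<Rightarrow> 'a \<Rightarrow> bool" where
  "superstable f x0 \<longleftrightarrow>
     local_solution f (\<lambda>_. 0) x0 \<and>
     (\<exists>\<epsilon>>0. \<forall>g\<in>finite_at x0. strong_slope g x0 < ereal \<epsilon> \<longrightarrow> local_solution f g x0)"

end

theory Submission
  imports Defs
begin

text \<open>Superstability only has to be tested on the perturbations \<open>x \<mapsto> - c * dist x xbar\<close>: their strong
  slope is at most \<open>c\<close>, and \<open>xbar\<close> solving the problem perturbed by one of them is exactly
  sharpness with modulus \<open>c\<close>. Conversely, a perturbation of slope less than \<open>\<sigma>\<close> decreases at rate
  at most \<open>\<sigma>\<close> near \<open>xbar\<close>, which the sharp growth of \<open>f\<close> compensates.\<close>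

text \<open>The two cases follow the two branches of \<open>strong_slope\<close>. Off local
  minimizers, a limsup below \<sigma> keeps the difference quotients below \<sigma> on a punctured
  neighbourhood.\<close>

lemma eventually_ge_if_strong_slope_less:
  assumes "g \<in> finite_at x0" "\<sigma> > 0" "strong_slope g x0 < ereal \<sigma>"
  shows "\<forall>\<^sub>F x in nhds x0. g x0 - ereal (\<sigma> * dist x x0) \<le> g x"
proof (cases "local_minimizer g x0")
  case True
  then show ?thesis
    unfolding local_minimizer_def
  proof eventually_elim
    case (elim x)
    have "g x0 - ereal (\<sigma> * dist x x0) \<le> g x0"
      using \<open>\<sigma> > 0\<close> by (cases "g x0") auto
    with elim show ?case by order
  qed
next
  case False
  obtain a where a: "g x0 = ereal a"
    using assms(1) by (auto simp: finite_at_def)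
  have "Limsup (at x0) (\<lambda>x. (g x0 - g x) / ereal (dist x x0)) < ereal \<sigma>"
    using assms(3) False by (simp add: strong_slope_def)
  then have "\<forall>\<^sub>F x in at x0. (g x0 - g x) / ereal (dist x x0) < ereal \<sigma>"
    by (rule Limsup_lessD)
  then have "\<forall>\<^sub>F x in nhds x0. x \<noteq> x0 \<longrightarrow> (g x0 - g x) / ereal (dist x x0) < ereal \<sigma>"
    by (simp add: eventually_at_filter)
  then show ?thesis
  proof eventually_elim
    case (elim x)
    show ?case
    proof (cases "x = x0")
      case True
      then show ?thesis by (simp add: a)
    next
      case False
      then have "(g x0 - g x) / ereal (dist x x0) < ereal \<sigma>" "dist x x0 > 0"
        using elim by auto
      then show ?thesis
        \<comment> \<open>\<open>g x = -\<infinity>\<close> would make the quotient \<infinity>, and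
          \<open>g x = \<infinity>\<close> is trivial; for finite \<open>g x\<close> the denominator
          is cleared.\<close>
        by (cases "g x") (auto simp: a field_simps)
    qed
  qed
qed

text \<open>Away from \<open>x0\<close> the difference quotient is constantly \<open>c\<close>. Only
  an inequality holds, since at an isolated point the slope is 0.\<close>

lemma strong_slope_neg_dist_le:
  assumes "c \<ge> 0"
  shows "strong_slope (\<lambda>x. ereal (- (c * dist x x0))) x0 \<le> ereal c"
proof -
  have "Limsup (at x0) (\<lambda>x. (ereal (- (c * dist x0 x0)) - ereal (- (c * dist x x0)))
      / ereal (dist x x0)) \<le> ereal c"
    by (rule Limsup_bounded) (auto simp: eventually_at_filter)
  with assms show ?thesis
    by (simp add: strong_slope_def)
qed

theorem proposition2:
  fixes f :: "'a::metric_space \<Rightarrow> ereal" and xbar :: 'a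
  assumes "\<bar>f xbar\<bar> < \<infinity>"
  shows "local_sharp_minimizer f xbar \<longleftrightarrow> superstable f xbar"
proof
  obtain b where b: "f xbar = ereal b"
    using assms by auto
  {
    assume "local_sharp_minimizer f xbar"
    then obtain \<sigma> r where \<sigma>: "\<sigma> > 0" and "r > 0"
      and sharp: "\<And>x. x \<in> cball xbar r \<Longrightarrow> f xbar + ereal (\<sigma> * dist x xbar) \<le> f x"
      by (auto simp: local_sharp_minimizer_def)
    have growth: "\<forall>\<^sub>F x in nhds xbar. f xbar + ereal (\<sigma> * dist x xbar) \<le> f x"
      unfolding eventually_nhds_metric
      using \<open>r > 0\<close> by (intro exI[of _ r]) (auto intro!: sharp simp: dist_commute)
    have stable: "local_solution f g xbar"
      if g: "g \<in> finite_at xbar" "strong_slope g xbar < ereal \<sigma>" for g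
    proof -
      obtain a where a: "g xbar = ereal a"
        using g(1) by (auto simp: finite_at_def)
      show ?thesis
        unfolding local_solution_def local_minimizer_def
        using growth eventually_ge_if_strong_slope_less[OF g(1) \<sigma> g(2)]
      proof eventually_elim
        case (elim x)
        \<comment> \<open>Inserting the real number \<open>\<sigma> * dist x xbar\<close> with both
          signs is harmless because \<open>f xbar\<close> and \<open>g xbar\<close> are finite; the
          two groups are the lower bounds for \<open>f x\<close> and \<open>g x\<close>.\<close>
        have "f xbar + g xbar
            = (f xbar + ereal (\<sigma> * dist x xbar)) + (g xbar - ereal (\<sigma> * dist x xbar))"
          by (simp add: a b)
        also have "\<dots> \<le> f x + g x"
          using elim by (rule add_mono)
        finally show ?case .
      qed
    qed
    have "strong_slope (\<lambda>_. 0) xbar = 0"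
      by (simp add: strong_slope_def local_minimizer_def)
    then have "local_solution f (\<lambda>_. 0) xbar"
      using \<sigma> by (intro stable) (auto simp: finite_at_def)
    with stable \<sigma> show "superstable f xbar"
      by (auto simp: superstable_def)
  next
    assume "superstable f xbar"
    then obtain \<epsilon> where \<epsilon>: "\<epsilon> > 0" and stable:
      "\<And>g. g \<in> finite_at xbar \<Longrightarrow> strong_slope g xbar < ereal \<epsilon> \<Longrightarrow> local_solution f g xbar"
      by (auto simp: superstable_def)
    \<comment> \<open>The slope is only bounded by \<open>c\<close>, while stability needs it
      strictly below \<epsilon>.\<close>
    define c where "c = \<epsilon> / 2"
    have c: "0 < c" "c < \<epsilon>"
      using \<epsilon> by (auto simp: c_def)
    have "strong_slope (\<lambda>x. ereal (- (c * dist x xbar))) xbar \<le> ereal c"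
      using c by (intro strong_slope_neg_dist_le) simp
    also have "\<dots> < ereal \<epsilon>"
      using c by simp
    finally have "local_solution f (\<lambda>x. ereal (- (c * dist x xbar))) xbar"
      by (intro stable) (auto simp: finite_at_def)
    then obtain r where "r > 0" and r: "\<And>x. dist x xbar < r \<Longrightarrow>
        f xbar \<le> f x + ereal (- (c * dist x xbar))"
      by (auto simp: local_solution_def local_minimizer_def eventually_nhds_metric)
    \<comment> \<open>Halving \<open>r\<close> fits the closed ball of sharpness into the open ball
      where \<open>r\<close> applies.\<close>
    have "f xbar + ereal (c * dist x xbar) \<le> f x" if "x \<in> cball xbar (r / 2)" for x
    proof -
      have "dist x xbar < r"
        using that \<open>r > 0\<close> by (simp add: dist_commute)
      from r[OF this] show ?thesis
        by (cases "f x") (auto simp: b)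
    qed
    with c \<open>r > 0\<close> show "local_sharp_minimizer f xbar"
      unfolding local_sharp_minimizer_def by (meson half_gt_zero)
  }
qed

end
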